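(* Suppose single-shot SBFT (with the view-1 optimization) is run with the FastSync synchronizer with timeout function $F$. Assume all processes are correct, $S_{\rm first}\ge\mathsf{GST}$, $F(1)>4\delta$ and $\mathsf{leader}(1)$ is correct. Then all correct processes decide no later than $S_{\rm last}+3\delta$.
   Context: Model. There are $n=3f+1$ processes $\mathcal P=\{p_1,\dots,p_n\}$, at most $f$ of which are faulty (Byzantine, behaving arbitrarily); the others are correct. A quorum is a set of $2f+1$ processes. Processes communicate over authenticated point-to-point links. Partial synchrony: there are a time $\mathsf{GST}$ and a bound $\delta$, both unknown to the protocol, such that after $\mathsf{GST}$ messages between correct processes are delayed by at most $\delta$; before $\mathsf{GST}$ messages may be arbitrarily delayed or lost (self-addressed messages are never lost). Local clocks may drift unboundedly before $\mathsf{GST}$ and do not drift from real time after it. Local processing takes zero time. $\langle m\rangle_i$ denotes $m$ signed by $p_i$; signatures are unforgeable and $\mathsf{hash}$ is collision-resistant (both idealized as perfect). Each correct process has a proposal $\mathtt{myval}()$ satisfying a given predicate $\mathsf{valid}$. Synchronizer. Views are $1,2,\dots$; $0$ denotes an invalid view. The synchronizer issues notifications $\mathtt{new\_view}(v)$ at each correct process, which then enters $v$ and stays in it until it enters another view. Each correct process eventually calls $\mathtt{start}()$; $S_{\rm first}$ and $S_{\rm last}$ are the earliest and latest times when a correct process does so. The timeout function $F:\{0,1,2,\dots\}\to\mathsf{Time}$ is monotone, $F(0)=0$, and for every $\theta$ there is $v$ with $F(v')>\theta$ for all $v'\ge v$. FastSync (code of $p_i$), with retransmission interval $\rho$. Each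 process has an array $\mathsf{max\_views}[1..n]$ and variables $\mathsf{view}$, $\mathsf{view}^+$, all initially $0$, and a timer $\mathsf{timer\_view}$, initially not enabled. "All" includes the sender. - $\mathtt{start}()$: if $\mathsf{view}^+=0$, send $\mathtt{WISH}(1)$ to all. - When $\mathsf{timer\_view}$ expires: send $\mathtt{WISH}(\max(\mathsf{view}+1,\mathsf{view}^+))$ to all. - Every $\rho$ units of local time: if $\mathsf{timer\_view}$ is enabled, send $\mathtt{WISH}(\mathsf{view}^+)$ to all; otherwise, if $\mathsf{max\_views}[i]>0$, send $\mathtt{WISH}(\max(\mathsf{view}+1,\mathsf{view}^+))$ to all. - When $\mathtt{WISH}(v)$ is received from $p_j$: let $prev=\mathsf{view}$, $prev^+=\mathsf{view}^+$. If $v>\mathsf{max\_views}[j]$, set $\mathsf{max\_views}[j]:=v$. Set $\mathsf{view}$ (resp. $\mathsf{view}^+$) to the largest value $u$ occurring in $\mathsf{max\_views}$ such that at least $2f+1$ (resp. $f+1$) entries are $\ge u$. If $\mathsf{view}^+=\mathsf{view}$ and $\mathsf{view}>prev$, restart $\mathsf{timer\_view}$ with duration $F(\mathsf{view})$ and issue $\mathtt{new\_view}(\mathsf{view})$. Finally, if $\mathsf{view}^+>prev^+$, send $\mathtt{WISH}(\mathsf{view}^+)$ to all. Single-shot (all-to-all) SBFT (code of $p_i$), with fast-path timeout function $F_f$. $\mathsf{leader}(v)=p_{((v-1)\bmod n)+1}$. Variables $\mathsf{curr\_view},\mathsf{locked\_view},\mathsf{pre\_view}$ are initially $0$; $\mathsf{curr\_val},\mathsf{prepared\_val},\mathsf{cert},\mathsf{voted}$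 are initially $\bot$; $\mathsf{timer\_fast\_path}$ is a timer. A handler runs when its trigger and precondition hold; messages for views higher than the current one are buffered (for each type and sender, only the one with the highest view is kept). 1. Upon $\mathtt{new\_view}(v)$: $\mathsf{curr\_view}:=v$; $\mathsf{voted}:=$ false; send $\langle\mathtt{NEWLEADER}(v,\mathsf{locked\_view},\mathsf{prepared\_val},\mathsf{cert},\mathsf{pre\_view},\mathsf{curr\_val})\rangle_i$ to $\mathsf{leader}(v)$. 2. (Once per view.) When messages $M=\{\langle\mathtt{NEWLEADER}(v,view_j,val_j,cert_j,pre_j,cur_j)\rangle_j\mid p_j\in Q\}$ are received for a quorum $Q$, with $\mathsf{curr\_view}=v$, $p_i=\mathsf{leader}(v)$ and ValidNewLeader$(m)$ for all $m\in M$: compute $(x_{\rm slow},v_{\rm slow},x_{\rm fast},v_{\rm fast})$ by the Selection rule below; if $v_{\rm slow}\ge v_{\rm fast}$ and $v_{\rm slow}>0$, send $\langle\mathtt{PROPOSE}(v,x_{\rm slow},M)\rangle_i$ to all; else if $v_{\rm fast}>v_{\rm slow}$, send $\langle\mathtt{PROPOSE}(v,x_{\rm fast},M)\rangle_i$ to all; else send $\langle\mathtt{PROPOSE}(v,\mathtt{myval}(),M)\rangle_i$ to all. 3. When $m=\langle\mathtt{PROPOSE}(v,x,\_)\rangle_j$ is received, with $\mathsf{curr\_view}=v$, $\mathsf{voted}=$ false, SafeProposal$(m)$: $\mathsf{curr\_val}:=x$; $\mathsf{pre\_view}:=v$; $\mathsf{voted}:=$ true; stop $\mathsf{timer\_fast\_path}$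 and start it with duration $F_f(v)$; send $\langle\mathtt{PREPARED}(v,\mathsf{hash}(x))\rangle_i$ to all. 4. (Fast path.) When $\{\langle\mathtt{PREPARED}(v,h)\rangle_j\mid p_j\in\mathcal P\}$ (from all processes) is received, with $\mathsf{curr\_view}=v$, $\mathsf{voted}=$ true, $\mathsf{hash}(\mathsf{curr\_val})=h$: decide $\mathsf{curr\_val}$. 5. When $\mathsf{timer\_fast\_path}$ has expired and $C=\{\langle\mathtt{PREPARED}(v,h)\rangle_j\mid p_j\in Q\}$ has been received for at least a quorum $Q$, with $\mathsf{curr\_view}=v$, $\mathsf{voted}=$ true, $\mathsf{hash}(\mathsf{curr\_val})=h$: $\mathsf{prepared\_val}:=\mathsf{curr\_val}$; $\mathsf{locked\_view}:=v$; $\mathsf{cert}:=C$; send $\langle\mathtt{COMMITTED}(v,h)\rangle_i$ to all. 6. When $\{\langle\mathtt{COMMITTED}(v,h)\rangle_j\mid p_j\in Q\}$ is received for a quorum $Q$, with $\mathsf{curr\_view}=\mathsf{locked\_view}=v$, $\mathsf{hash}(\mathsf{curr\_val})=h$: decide $\mathsf{curr\_val}$. Selection rule. $(x_{\rm slow},v_{\rm slow})=(val_j,view_j)$ for some $j$ with $view_j=\max\{view_k\mid p_k\in Q\}$ if this maximum is nonzero, else $(\bot,0)$. Let $D$ be the set of pairs $(x,u)$ for which there is $P\subseteq Q$ with $|P|=f+1$, $cur_j=x$ for all $p_j\in P$, and $u=\min\{pre_j\mid p_j\in P\}$. Let $u^*=\max\{u\mid(\_,u)\in D\}$; if there is exactly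 one $x$ with $(x,u^* )\in D$, then $(x_{\rm fast},v_{\rm fast})=(x,u^* )$; otherwise (including $D=\emptyset$) $(x_{\rm fast},v_{\rm fast})=(\bot,0)$. View-1 optimization: in view $1$ the leader proposes $\mathtt{myval}()$ immediately on entering, without waiting for $\mathtt{NEWLEADER}$ messages (which need not be sent to it), and SafeProposal for view $1$ only requires that the sender is $\mathsf{leader}(1)$ and the value is valid. Predicates: prepared$(C,v,h)$ iff $C=\{\langle\mathtt{PREPARED}(v,h)\rangle_j\mid p_j\in Q\}$ for some quorum $Q$ (a certificate with more than $2f+1$ messages is also accepted). ValidNewLeader$(\langle\mathtt{NEWLEADER}(v',v,x,C,v_0,x_0)\rangle_{\_})$ iff $v\le v_0<v'$ and ($v\ne0$ implies prepared$(C,v,\mathsf{hash}(x))$). SafeProposal$(\langle\mathtt{PROPOSE}(v,x,M)\rangle_i)$ iff $p_i=\mathsf{leader}(v)$, $\mathsf{valid}(x)$, $M$ is a set of $\mathtt{NEWLEADER}$ messages for view $v$ signed by the members of some quorum $Q$, all satisfying ValidNewLeader, and for $v_{\rm slow},v_{\rm fast},x_{\rm slow},x_{\rm fast}$ computed from $M$ by the Selection rule: ($v_{\rm slow}\ge v_{\rm fast}$ and $v_{\rm slow}>0$ imply $x=x_{\rm slow}$) and ($v_{\rm slow}<v_{\rm fast}$ implies $x=x_{\rm fast}$). *)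

theory Defs
  imports Complex_Main
begin

section \<open>Parameters\<close>

type_synonym proc = nat
type_synonym view = nat

record ('v, 'h) protocol =
  max_faults :: nat                     \<comment> \<open>the resilience threshold \<open>f\<close>\<close>
  view_timeout :: "view \<Rightarrow> real"        \<comment> \<open>\<open>F\<close>\<close>
  fast_timeout :: "view \<Rightarrow> real"        \<comment> \<open>\<open>F\<^sub>f\<close>\<close>
  resend_interval :: real               \<comment> \<open>\<open>\<rho>\<close>\<close>
  hash :: "'v option \<Rightarrow> 'h"
  valid :: "'v \<Rightarrow> bool"
  myval :: "proc \<Rightarrow> 'v"

text \<open>
  Values that may be \<open>\<bottom>\<close> are options, with \<open>None\<close> for \<open>\<bottom>\<close>; collision resistance of \<open>hash\<close> is
  idealised as injectivity.
\<close>

definition wf_protocol :: "('v, 'h) protocol \<Rightarrow> bool" where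
  "wf_protocol P \<longleftrightarrow>
     mono (view_timeout P) \<and> view_timeout P 0 = 0 \<and>
     (\<forall>\<theta>. \<exists>v. \<forall>v'\<ge>v. view_timeout P v' > \<theta>) \<and>
     (\<forall>v. fast_timeout P v \<ge> 0) \<and>
     resend_interval P > 0 \<and>
     inj (hash P)"

definition num_procs :: "('v, 'h) protocol \<Rightarrow> nat" where
  "num_procs P = 3 * max_faults P + 1"

definition procs :: "('v, 'h) protocol \<Rightarrow> proc set" where
  "procs P = {1..num_procs P}"

definition quorum :: "('v, 'h) protocol \<Rightarrow> proc set \<Rightarrow> bool" where
  "quorum P Q \<longleftrightarrow> Q \<subseteq> procs P \<and> card Q = 2 * max_faults P + 1"

definition leader :: "('v, 'h) protocol \<Rightarrow> view \<Rightarrow> proc" where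
  "leader P v = (v - 1) mod num_procs P + 1"


section \<open>Messages\<close>

text \<open>
  The first process component of a signed message is its signer. \<open>Wish\<close> is the only unsigned
  message; its sender is known from the authenticated link.
\<close>

datatype 'h prepared_msg = PREPARED (pr_signer: proc) (pr_view: view) (pr_hash: 'h)

datatype ('v, 'h) newleader_msg =
  NEWLEADER (nl_signer: proc) (nl_for: view) (nl_view: view) (nl_val: "'v option")
    (nl_cert: "'h prepared_msg set option") (nl_pre: view) (nl_cur: "'v option")

datatype ('v, 'h) msg =
    Wish view
  | NewLeader "('v, 'h) newleader_msg"
  | Propose proc view "'v option" "('v, 'h) newleader_msg set"
  | Prepared "'h prepared_msg"
  | Committed proc view 'h

datatype kind = K_Wish | K_NewLeader | K_Propose | K_Prepared | K_Committed

fun msg_kind :: "('v, 'h) msg \<Rightarrow> kind" where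
  "msg_kind (Wish v) = K_Wish"
| "msg_kind (NewLeader m) = K_NewLeader"
| "msg_kind (Propose j v x M) = K_Propose"
| "msg_kind (Prepared m) = K_Prepared"
| "msg_kind (Committed j v h) = K_Committed"

fun msg_view :: "('v, 'h) msg \<Rightarrow> view" where
  "msg_view (Wish v) = v"
| "msg_view (NewLeader m) = nl_for m"
| "msg_view (Propose j v x M) = v"
| "msg_view (Prepared m) = pr_view m"
| "msg_view (Committed j v h) = v"

text \<open>The signatures occurring in a message, including those nested in proposals and certificates.\<close>

fun newleader_signatures :: "('v, 'h) newleader_msg \<Rightarrow> (proc \<times> ('v, 'h) msg) set" where
  "newleader_signatures m =
     insert (nl_signer m, NewLeader m)
       ((\<lambda>c. (pr_signer c, Prepared c)) ` (case nl_cert m of None \<Rightarrow> {} | Some C \<Rightarrow> C))"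

fun signatures :: "('v, 'h) msg \<Rightarrow> (proc \<times> ('v, 'h) msg) set" where
  "signatures (Wish v) = {}"
| "signatures (NewLeader m) = newleader_signatures m"
| "signatures (Propose j v x M) =
     insert (j, Propose j v x M) (\<Union>m\<in>M. newleader_signatures m)"
| "signatures (Prepared m) = {(pr_signer m, Prepared m)}"
| "signatures (Committed j v h) = {(j, Committed j v h)}"

fun same_signer :: "('v, 'h) msg \<Rightarrow> ('v, 'h) msg \<Rightarrow> bool" where
  "same_signer (NewLeader m) (NewLeader m') \<longleftrightarrow> nl_signer m = nl_signer m'"
| "same_signer (Propose j v x M) (Propose j' v' x' M') \<longleftrightarrow> j = j'"
| "same_signer (Prepared m) (Prepared m') \<longleftrightarrow> pr_signer m = pr_signer m'"
| "same_signer (Committed j v h) (Committed j' v' h') \<longleftrightarrow> j = j'"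
| "same_signer _ _ \<longleftrightarrow> False"

definition to_all :: "('v, 'h) protocol \<Rightarrow> ('v, 'h) msg \<Rightarrow> (proc \<times> ('v, 'h) msg) set" where
  "to_all P m = (\<lambda>j. (j, m)) ` procs P"


section \<open>Predicates and the selection rule\<close>

definition prepared ::
  "('v, 'h) protocol \<Rightarrow> 'h prepared_msg set option \<Rightarrow> view \<Rightarrow> 'h \<Rightarrow> bool" where
  "prepared P C v h \<longleftrightarrow>
     (\<exists>Q. Q \<subseteq> procs P \<and> card Q \<ge> 2 * max_faults P + 1 \<and>
          C = Some ((\<lambda>j. PREPARED j v h) ` Q))"

definition valid_newleader :: "('v, 'h) protocol \<Rightarrow> ('v, 'h) newleader_msg \<Rightarrow> bool" where
  "valid_newleader P m \<longleftrightarrow>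
     nl_view m \<le> nl_pre m \<and> nl_pre m < nl_for m \<and>
     (nl_view m \<noteq> 0 \<longrightarrow> prepared P (nl_cert m) (nl_view m) (hash P (nl_val m)))"

definition valid_newleader_quorum ::
  "('v, 'h) protocol \<Rightarrow> view \<Rightarrow> ('v, 'h) newleader_msg set \<Rightarrow> bool" where
  "valid_newleader_quorum P v M \<longleftrightarrow>
     (\<exists>Q. quorum P Q \<and> bij_betw nl_signer M Q) \<and>
     (\<forall>m\<in>M. nl_for m = v \<and> valid_newleader P m)"

text \<open>
  The selection rule leaves open which of the messages of the highest view provides the slow-path
  value, so its outcome is a relation.
\<close>

definition slow_choice :: "('v, 'h) newleader_msg set \<Rightarrow> 'v option \<Rightarrow> view \<Rightarrow> bool" where
  "slow_choice M x v \<longleftrightarrow>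
     v = Max (nl_view ` M) \<and>
     (if v \<noteq> 0 then \<exists>m\<in>M. nl_view m = v \<and> nl_val m = x else x = None)"

definition fast_candidates ::
  "('v, 'h) protocol \<Rightarrow> ('v, 'h) newleader_msg set \<Rightarrow> ('v option \<times> view) set" where
  "fast_candidates P M =
     {(x, u). \<exists>A\<subseteq>M. card A = max_faults P + 1 \<and> (\<forall>m\<in>A. nl_cur m = x) \<and> u = Min (nl_pre ` A)}"

definition fast_choice ::
  "('v, 'h) protocol \<Rightarrow> ('v, 'h) newleader_msg set \<Rightarrow> 'v option \<times> view" where
  "fast_choice P M =
     (let D = fast_candidates P M; u = Max (snd ` D) in
      if D \<noteq> {} \<and> (\<exists>!x. (x, u) \<in> D) then (THE x. (x, u) \<in> D, u) else (None, 0))"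

definition selection ::
  "('v, 'h) protocol \<Rightarrow> ('v, 'h) newleader_msg set \<Rightarrow>
   'v option \<Rightarrow> view \<Rightarrow> 'v option \<Rightarrow> view \<Rightarrow> bool" where
  "selection P M xs vs xf vf \<longleftrightarrow> slow_choice M xs vs \<and> fast_choice P M = (xf, vf)"

definition leader_choice ::
  "('v, 'h) protocol \<Rightarrow> proc \<Rightarrow> ('v, 'h) newleader_msg set \<Rightarrow> 'v option \<Rightarrow> bool" where
  "leader_choice P i M x \<longleftrightarrow>
     (\<exists>xs vs xf vf. selection P M xs vs xf vf \<and>
        x = (if vs \<ge> vf \<and> vs > 0 then xs else if vf > vs then xf else Some (myval P i)))"

text \<open>For view 1 the justification \<open>M\<close> is not inspected, because of the view-1 optimisation.\<close>

definition safe_proposal ::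
  "('v, 'h) protocol \<Rightarrow> proc \<Rightarrow> view \<Rightarrow> 'v option \<Rightarrow> ('v, 'h) newleader_msg set \<Rightarrow> bool" where
  "safe_proposal P i v x M \<longleftrightarrow>
     i = leader P v \<and> (\<exists>w. x = Some w \<and> valid P w) \<and>
     (v \<noteq> 1 \<longrightarrow>
        valid_newleader_quorum P v M \<and>
        (\<exists>xs vs xf vf. selection P M xs vs xf vf \<and>
           (vs \<ge> vf \<and> vs > 0 \<longrightarrow> x = xs) \<and> (vs < vf \<longrightarrow> x = xf)))"


section \<open>Local states and handlers\<close>

datatype handler = H_Propose | H_Fast | H_Lock | H_Slow

text \<open>
  A timer is \<open>None\<close> while not enabled, and otherwise holds the reading of the local clock at which it
  expires. The set \<open>fired\<close> records the handlers already executed in a view, so that a handler whose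
  precondition stays true runs only once per view.
\<close>

record ('v, 'h) pstate =
  max_views :: "proc \<Rightarrow> view"
  view :: view
  view_plus :: view
  timer_view :: "real option"
  resend_at :: real
  curr_view :: view
  locked_view :: view
  pre_view :: view
  curr_val :: "'v option"
  prepared_val :: "'v option"
  cert :: "'h prepared_msg set option"
  voted :: "bool option"
  timer_fast_path :: "real option"
  inbox :: "('v, 'h) msg set"
  fired :: "(handler \<times> view) set"

definition init_pstate :: "real \<Rightarrow> ('v, 'h) pstate" where
  "init_pstate a =
     \<lparr>max_views = (\<lambda>_. 0), view = 0, view_plus = 0, timer_view = None, resend_at = a,
      curr_view = 0, locked_view = 0, pre_view = 0, curr_val = None, prepared_val = None,
      cert = None, voted = None, timer_fast_path = None, inbox = {}, fired = {}\<rparr>"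

datatype ('v, 'h) event =
    Start
  | Receive proc "('v, 'h) msg"
  | View_Timeout
  | Resend
  | Lead
  | Vote
  | Lock
  | Decide 'v
  | Byzantine

definition supported_view :: "('v, 'h) protocol \<Rightarrow> nat \<Rightarrow> (proc \<Rightarrow> view) \<Rightarrow> view" where
  "supported_view P k mv = Max {u \<in> mv ` procs P. card {j \<in> procs P. mv j \<ge> u} \<ge> k}"

definition enter_view :: "view \<Rightarrow> ('v, 'h) pstate \<Rightarrow> ('v, 'h) pstate" where
  "enter_view v s = s\<lparr>curr_view := v, voted := Some False\<rparr>"

definition enter_msgs ::
  "('v, 'h) protocol \<Rightarrow> proc \<Rightarrow> view \<Rightarrow> ('v, 'h) pstate \<Rightarrow> (proc \<times> ('v, 'h) msg) set" where
  "enter_msgs P i v s =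
     (if v = 1
      then (if i = leader P 1 then to_all P (Propose i 1 (Some (myval P i)) {}) else {})
      else {(leader P v,
             NewLeader (NEWLEADER i v (locked_view s) (prepared_val s) (cert s) (pre_view s)
                          (curr_val s)))})"

text \<open>
  Reception of \<open>WISH(v)\<close> from \<open>j\<close> by \<open>i\<close> when the local clock of \<open>i\<close> shows \<open>c\<close>. The handler of
  \<open>new_view\<close> is executed in the same atomic step as the notification.
\<close>

definition on_wish ::
  "('v, 'h) protocol \<Rightarrow> proc \<Rightarrow> real \<Rightarrow> proc \<Rightarrow> view \<Rightarrow> ('v, 'h) pstate \<Rightarrow>
   ('v, 'h) pstate \<times> (proc \<times> ('v, 'h) msg) set" where
  "on_wish P i c j v s =
     (let mv = (if v > max_views s j then (max_views s)(j := v) else max_views s);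
          w = supported_view P (2 * max_faults P + 1) mv;
          w' = supported_view P (max_faults P + 1) mv;
          s1 = s\<lparr>max_views := mv, view := w, view_plus := w'\<rparr>;
          wishes = (if w' > view_plus s then to_all P (Wish w') else {})
      in if w' = w \<and> w > view s
         then (enter_view w (s1\<lparr>timer_view := Some (c + view_timeout P w)\<rparr>),
               enter_msgs P i w s1 \<union> wishes)
         else (s1, wishes))"

definition store :: "('v, 'h) msg \<Rightarrow> ('v, 'h) pstate \<Rightarrow> ('v, 'h) pstate" where
  "store m s =
     (let old = {m' \<in> inbox s. msg_kind m' = msg_kind m \<and> same_signer m' m \<and>
                               msg_view m' > curr_view s}
      in if msg_view m \<le> curr_view s then s\<lparr>inbox := insert m (inbox s)\<rparr>
         else if \<exists>m'\<in>old. msg_view m' \<ge> msg_view m then s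
         else s\<lparr>inbox := insert m (inbox s - old)\<rparr>)"

text \<open>
  \<open>step P i c s e s' out\<close>: in state \<open>s\<close> and at local clock reading \<open>c\<close>, the correct process \<open>i\<close> can
  execute \<open>e\<close>, moving to \<open>s'\<close> and sending the messages \<open>out\<close> (pairs of receiver and message).
\<close>

inductive step ::
  "('v, 'h) protocol \<Rightarrow> proc \<Rightarrow> real \<Rightarrow> ('v, 'h) pstate \<Rightarrow> ('v, 'h) event \<Rightarrow>
   ('v, 'h) pstate \<Rightarrow> (proc \<times> ('v, 'h) msg) set \<Rightarrow> bool"
  for P :: "('v, 'h) protocol" and i :: proc and c :: real and s :: "('v, 'h) pstate" where
  start:
    "step P i c s Start s (if view_plus s = 0 then to_all P (Wish 1) else {})"
| receive_wish:
    "on_wish P i c j v s = (s', out) \<Longrightarrow> step P i c s (Receive j (Wish v)) s' out"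
| receive:
    "msg_kind m \<noteq> K_Wish \<Longrightarrow> step P i c s (Receive j m) (store m s) {}"
| view_timeout:
    "timer_view s = Some d \<Longrightarrow> d \<le> c \<Longrightarrow>
     step P i c s View_Timeout (s\<lparr>timer_view := None\<rparr>)
       (to_all P (Wish (max (view s + 1) (view_plus s))))"
| resend:
    "resend_at s \<le> c \<Longrightarrow>
     step P i c s Resend (s\<lparr>resend_at := c + resend_interval P\<rparr>)
       (if timer_view s \<noteq> None then to_all P (Wish (view_plus s))
        else if max_views s i > 0 then to_all P (Wish (max (view s + 1) (view_plus s)))
        else {})"
| lead:
    "curr_view s = v \<Longrightarrow> v \<noteq> 1 \<Longrightarrow> i = leader P v \<Longrightarrow> (H_Propose, v) \<notin> fired s \<Longrightarrow>
     NewLeader ` M \<subseteq> inbox s \<Longrightarrow> valid_newleader_quorum P v M \<Longrightarrow> leader_choice P i M x \<Longrightarrow>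
     step P i c s Lead (s\<lparr>fired := insert (H_Propose, v) (fired s)\<rparr>)
       (to_all P (Propose i v x M))"
| vote:
    "Propose j v x M \<in> inbox s \<Longrightarrow> curr_view s = v \<Longrightarrow> voted s = Some False \<Longrightarrow>
     safe_proposal P j v x M \<Longrightarrow>
     step P i c s Vote
       (s\<lparr>curr_val := x, pre_view := v, voted := Some True,
          timer_fast_path := Some (c + fast_timeout P v)\<rparr>)
       (to_all P (Prepared (PREPARED i v (hash P x))))"
| decide_fast:
    "\<forall>j\<in>procs P. Prepared (PREPARED j v h) \<in> inbox s \<Longrightarrow>
     curr_view s = v \<Longrightarrow> voted s = Some True \<Longrightarrow> hash P (curr_val s) = h \<Longrightarrow>
     curr_val s = Some x \<Longrightarrow> (H_Fast, v) \<notin> fired s \<Longrightarrow>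
     step P i c s (Decide x) (s\<lparr>fired := insert (H_Fast, v) (fired s)\<rparr>) {}"
| lock:
    "timer_fast_path s = Some d \<Longrightarrow> d \<le> c \<Longrightarrow>
     Q \<subseteq> procs P \<Longrightarrow> card Q \<ge> 2 * max_faults P + 1 \<Longrightarrow>
     \<forall>j\<in>Q. Prepared (PREPARED j v h) \<in> inbox s \<Longrightarrow>
     curr_view s = v \<Longrightarrow> voted s = Some True \<Longrightarrow> hash P (curr_val s) = h \<Longrightarrow>
     (H_Lock, v) \<notin> fired s \<Longrightarrow>
     step P i c s Lock
       (s\<lparr>prepared_val := curr_val s, locked_view := v,
          cert := Some ((\<lambda>j. PREPARED j v h) ` Q), fired := insert (H_Lock, v) (fired s)\<rparr>)
       (to_all P (Committed i v h))"
| decide_slow: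
    "quorum P Q \<Longrightarrow> \<forall>j\<in>Q. Committed j v h \<in> inbox s \<Longrightarrow>
     curr_view s = v \<Longrightarrow> locked_view s = v \<Longrightarrow> hash P (curr_val s) = h \<Longrightarrow>
     curr_val s = Some x \<Longrightarrow> (H_Slow, v) \<notin> fired s \<Longrightarrow>
     step P i c s (Decide x) (s\<lparr>fired := insert (H_Slow, v) (fired s)\<rparr>) {}"

text \<open>\<open>start()\<close> and message receptions are triggered by the environment, the other handlers are not.\<close>

definition urgent :: "('v, 'h) protocol \<Rightarrow> proc \<Rightarrow> real \<Rightarrow> ('v, 'h) pstate \<Rightarrow> bool" where
  "urgent P i c s \<longleftrightarrow>
     (\<exists>e s' out. step P i c s e s' out \<and> e \<noteq> Start \<and> (\<forall>j m. e \<noteq> Receive j m))"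


section \<open>Timed executions\<close>

text \<open>
  The \<open>k\<close>-th step of an execution occurs at real time \<open>time k\<close> at process \<open>actor k\<close>, leads from the
  local states \<open>pstates k\<close> to \<open>pstates (Suc k)\<close> and sends \<open>sent k\<close>. If it is a reception, \<open>origin k\<close>
  is the index of the step that sent the message. \<open>clock i t\<close> is the reading of the local clock of
  \<open>i\<close> at real time \<open>t\<close>.
\<close>

record ('v, 'h) execution =
  faulty :: "proc set"
  GST :: real
  delta :: real
  clock :: "proc \<Rightarrow> real \<Rightarrow> real"
  time :: "nat \<Rightarrow> real"
  actor :: "nat \<Rightarrow> proc"
  event :: "nat \<Rightarrow> ('v, 'h) event"
  origin :: "nat \<Rightarrow> nat"
  pstates :: "nat \<Rightarrow> proc \<Rightarrow> ('v, 'h) pstate"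
  sent :: "nat \<Rightarrow> (proc \<times> ('v, 'h) msg) set"

definition correct :: "('v, 'h) protocol \<Rightarrow> ('v, 'h) execution \<Rightarrow> proc set" where
  "correct P R = procs P - faulty R"

definition wf_times :: "('v, 'h) protocol \<Rightarrow> ('v, 'h) execution \<Rightarrow> bool" where
  "wf_times P R \<longleftrightarrow>
     0 \<le> delta R \<and> 0 \<le> time R 0 \<and> mono (time R) \<and> (\<forall>t. \<exists>k. time R k > t)"

definition wf_clocks :: "('v, 'h) protocol \<Rightarrow> ('v, 'h) execution \<Rightarrow> bool" where
  "wf_clocks P R \<longleftrightarrow>
     (\<forall>i\<in>correct P R. mono (clock R i) \<and>
        (\<forall>t t'. GST R \<le> t \<and> t \<le> t' \<longrightarrow> clock R i t' - clock R i t = t' - t))"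

definition correct_steps :: "('v, 'h) protocol \<Rightarrow> ('v, 'h) execution \<Rightarrow> bool" where
  "correct_steps P R \<longleftrightarrow>
     (\<forall>i\<in>correct P R. \<exists>a. clock R i 0 \<le> a \<and> a \<le> clock R i 0 + resend_interval P \<and>
        pstates R 0 i = init_pstate a) \<and>
     (\<forall>k. \<forall>i\<in>correct P R.
        if actor R k = i
        then step P i (clock R i (time R k)) (pstates R k i) (event R k)
               (pstates R (Suc k) i) (sent R k)
        else pstates R (Suc k) i = pstates R k i)"

text \<open>
  Processing takes zero time: at any time \<open>t\<close> strictly between two consecutive steps, or at that of
  the earlier one, no correct process has an enabled handler. In particular a timer fires when it
  expires.
\<close>

definition zero_processing_time :: "('v, 'h) protocol \<Rightarrow> ('v, 'h) execution \<Rightarrow> bool" where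
  "zero_processing_time P R \<longleftrightarrow>
     (\<forall>k t. 0 \<le> t \<and> (\<forall>l<k. time R l \<le> t) \<and> t < time R k \<longrightarrow>
        (\<forall>i\<in>correct P R. \<not> urgent P i (clock R i t) (pstates R k i)))"

text \<open>
  Faulty processes may send anything at any time, except for signatures of correct processes that
  these have not themselves sent before.
\<close>

definition unforgeable :: "('v, 'h) protocol \<Rightarrow> ('v, 'h) execution \<Rightarrow> bool" where
  "unforgeable P R \<longleftrightarrow>
     (\<forall>k. actor R k \<in> faulty R \<longrightarrow>
        (\<forall>(j, m)\<in>sent R k. \<forall>(i, a)\<in>signatures m. i \<in> correct P R \<longrightarrow>
           (\<exists>l<k. actor R l = i \<and> (\<exists>(j', m')\<in>sent R l. (i, a) \<in> signatures m'))))"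

text \<open>
  Links deliver only what the claimed sender has sent, each message at most once. Messages sent
  from time \<open>GST\<close> on between correct processes arrive within \<open>delta\<close>; earlier ones need not
  arrive, unless they are self-addressed.
\<close>

definition partially_synchronous_links ::
  "('v, 'h) protocol \<Rightarrow> ('v, 'h) execution \<Rightarrow> bool" where
  "partially_synchronous_links P R \<longleftrightarrow>
     (\<forall>k j m. actor R k \<in> correct P R \<and> event R k = Receive j m \<longrightarrow>
        origin R k < k \<and> actor R (origin R k) = j \<and> (actor R k, m) \<in> sent R (origin R k)) \<and>
     (\<forall>k k' j m. actor R k \<in> correct P R \<and> actor R k' = actor R k \<and>
        event R k = Receive j m \<and> event R k' = Receive j m \<and> origin R k = origin R k' \<longrightarrow>
        k = k') \<and>
     (\<forall>l i m. actor R l \<in> correct P R \<and> i \<in> correct P R \<and> (i, m) \<in> sent R l \<longrightarrow>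
        (GST R \<le> time R l \<longrightarrow>
           (\<exists>k. actor R k = i \<and> event R k = Receive (actor R l) m \<and> origin R k = l \<and>
                time R k \<le> time R l + delta R)) \<and>
        (i = actor R l \<longrightarrow>
           (\<exists>k. actor R k = i \<and> event R k = Receive (actor R l) m \<and> origin R k = l)))"

definition starts_once :: "('v, 'h) protocol \<Rightarrow> ('v, 'h) execution \<Rightarrow> bool" where
  "starts_once P R \<longleftrightarrow> (\<forall>i\<in>correct P R. \<exists>!k. actor R k = i \<and> event R k = Start)"

definition execution_of :: "('v, 'h) protocol \<Rightarrow> ('v, 'h) execution \<Rightarrow> bool" where
  "execution_of P R \<longleftrightarrow>
     faulty R \<subseteq> procs P \<and> card (faulty R) \<le> max_faults P \<and>
     (\<forall>k. actor R k \<in> procs P) \<and>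
     (\<forall>i\<in>correct P R. valid P (myval P i)) \<and>
     wf_times P R \<and> wf_clocks P R \<and> correct_steps P R \<and> zero_processing_time P R \<and>
     unforgeable P R \<and> partially_synchronous_links P R \<and> starts_once P R"

definition start_time :: "('v, 'h) execution \<Rightarrow> proc \<Rightarrow> real" where
  "start_time R i = time R (THE k. actor R k = i \<and> event R k = Start)"

definition S_first :: "('v, 'h) protocol \<Rightarrow> ('v, 'h) execution \<Rightarrow> real" where
  "S_first P R = Min (start_time R ` correct P R)"

definition S_last :: "('v, 'h) protocol \<Rightarrow> ('v, 'h) execution \<Rightarrow> real" where
  "S_last P R = Max (start_time R ` correct P R)"

definition decides_at :: "('v, 'h) execution \<Rightarrow> proc \<Rightarrow> 'v \<Rightarrow> real \<Rightarrow> bool" where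
  "decides_at R i x t \<longleftrightarrow> (\<exists>k. actor R k = i \<and> time R k = t \<and> event R k = Decide x)"

end

theory Submission
  imports Defs
begin

text \<open>
  Let \<open>T\<close> be the smaller of \<open>S\<^sub>l\<^sub>a\<^sub>s\<^sub>t\<close> and the first time when some process enters view 1. By time \<open>T\<close> a
  quorum has sent \<open>WISH(1)\<close> to everybody, so everybody is in view 1 by \<open>T + \<delta>\<close>, has received the
  leader's proposal and voted for it by \<open>T + 2\<delta>\<close>, and has received all votes by \<open>T + 3\<delta>\<close>, which
  triggers the fast path. Nobody leaves view 1 before, because a timer of duration \<open>F(1) > 4\<delta>\<close> has
  to expire for a \<open>WISH(2)\<close> to be sent, and no timer is started before \<open>T\<close>.
\<close>

section \<open>Processes and order statistics of arrays of views\<close>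

lemma finite_procs [simp]: "finite (procs P)"
  by (simp add: procs_def)

lemma card_procs: "card (procs P) = 3 * max_faults P + 1"
  by (simp add: procs_def num_procs_def)

lemma leader_in_procs: "leader P v \<in> procs P"
  by (simp add: leader_def procs_def num_procs_def Suc_le_eq)

lemma in_to_all [simp]: "(j, m) \<in> to_all P m' \<longleftrightarrow> j \<in> procs P \<and> m = m'"
  by (auto simp: to_all_def)

text \<open>\<open>supported_view\<close> is the \<open>k\<close>-th largest entry, so on a 0-1
  array it becomes a counting test. \<open>k \<le> card (procs P)\<close> puts 0 among the
  candidates when there are too few ones, so that \<open>Max\<close> is not taken of an empty set;
  \<open>1 \<le> k\<close> ensures that a reached threshold comes with an entry that is actually
  1.\<close>

lemma supported_view_binary:
  assumes "\<forall>j. mv j \<le> (1::nat)" and "1 \<le> k" and "k \<le> card (procs P)"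
  shows "supported_view P k mv = (if k \<le> card {j \<in> procs P. 1 \<le> mv j} then 1 else 0)"
proof -
  let ?S = "{u \<in> mv ` procs P. card {j \<in> procs P. mv j \<ge> u} \<ge> k}"
  have fin: "finite ?S" by simp
  show ?thesis
  proof (cases "k \<le> card {j \<in> procs P. 1 \<le> mv j}")
    case True
    then have "{j \<in> procs P. 1 \<le> mv j} \<noteq> {}" using assms(2) by (metis card.empty not_one_le_zero le_trans)
    then obtain j where "j \<in> procs P" "1 \<le> mv j" by blast
    with assms(1) have "mv j = 1" by (simp add: le_antisym)
    with \<open>j \<in> procs P\<close> True have "1 \<in> ?S" by force
    with fin assms(1) have "Max ?S = 1" by (intro Max_eqI) auto
    with True show ?thesis by (simp add: supported_view_def)
  next
    case False
    then have "{j \<in> procs P. 1 \<le> mv j} \<noteq> procs P" using assms(3) by auto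
    then obtain j where j: "j \<in> procs P" "\<not> 1 \<le> mv j" by blast
    then have "0 \<in> ?S" using assms(3) by force
    moreover have "u \<le> 0" if "u \<in> ?S" for u
    proof -
      have "u \<noteq> 1" using that False by auto
      moreover have "u \<le> 1" using that assms(1) by auto
      ultimately show ?thesis by linarith
    qed
    ultimately have "Max ?S = 0" using fin by (intro Max_eqI) auto
    with False show ?thesis by (simp add: supported_view_def)
  qed
qed

text \<open>This forces \<open>view_plus\<close> to be 1 whenever \<open>view\<close> becomes 1, so
  the condition \<open>view_plus = view\<close> never delays the entry into view 1.\<close>

lemma supported_view_le_plus:
  assumes "\<forall>j. mv j \<le> (1::nat)"
  shows "supported_view P (2 * max_faults P + 1) mv \<le> supported_view P (max_faults P + 1) mv"
    "supported_view P (max_faults P + 1) mv \<le> 1"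
  using supported_view_binary[OF assms, of "2 * max_faults P + 1" P]
    supported_view_binary[OF assms, of "max_faults P + 1" P] by (simp_all add: card_procs)

section \<open>Messages and states of a run that stays within views 0 and 1\<close>

definition view1_proposal :: "('v, 'h) protocol \<Rightarrow> ('v, 'h) msg" where
  "view1_proposal P = Propose (leader P 1) 1 (Some (myval P (leader P 1))) {}"

definition view1_vote :: "('v, 'h) protocol \<Rightarrow> proc \<Rightarrow> ('v, 'h) msg" where
  "view1_vote P i = Prepared (PREPARED i 1 (hash P (Some (myval P (leader P 1)))))"

text \<open>Fixing proposals and votes up to the signer makes equivocation impossible, which later
  protects them from eviction from the buffer.\<close>

definition view1_msg :: "('v, 'h) protocol \<Rightarrow> ('v, 'h) msg \<Rightarrow> bool" where
  "view1_msg P m \<longleftrightarrow>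
     (\<forall>v. m = Wish v \<longrightarrow> v \<le> 1) \<and>
     (msg_kind m = K_Propose \<longrightarrow> m = view1_proposal P) \<and>
     (msg_kind m = K_Prepared \<longrightarrow> (\<exists>i. m = view1_vote P i))"

text \<open>\<open>curr_view s = view s\<close> ties the consensus layer to the synchronizer. The
  timer clause says that a timer started on entry is never found disabled, which keeps
  retransmissions from asking for view 2.\<close>

definition view1_state :: "('v, 'h) protocol \<Rightarrow> ('v, 'h) pstate \<Rightarrow> bool" where
  "view1_state P s \<longleftrightarrow>
     (\<forall>j. max_views s j \<le> 1) \<and>
     view s = supported_view P (2 * max_faults P + 1) (max_views s) \<and>
     view_plus s = supported_view P (max_faults P + 1) (max_views s) \<and>
     curr_view s = view s \<and>
     (timer_view s = None \<longleftrightarrow> view s = 0) \<and>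
     (voted s = None \<longleftrightarrow> view s = 0) \<and>
     (voted s = Some True \<longrightarrow> curr_val s = Some (myval P (leader P 1))) \<and>
     (\<forall>m\<in>inbox s. view1_msg P m)"

lemma view1_state_bounds:
  assumes "view1_state P s"
  shows "view s \<le> view_plus s" "view_plus s \<le> 1" "view s \<le> 1"
  using assms supported_view_le_plus[of "max_views s" P] unfolding view1_state_def by auto

lemma view1_state_init: "view1_state P (init_pstate a)"
  by (simp add: view1_state_def init_pstate_def supported_view_binary card_procs)

text \<open>Entries of \<open>max_views\<close> only grow, hence so do the counts and
  \<open>view\<close>. Either \<open>view\<close> rises from 0 to 1, with \<open>view_plus\<close>
  forced to 1 as well, and the entry code restores the clauses on \<open>curr_view\<close>, timer
  and \<open>voted\<close>; or \<open>view\<close> is unchanged and these fields are not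
  touched.\<close>

lemma on_wish_view1:
  assumes s: "view1_state P s" and v: "v \<le> 1" and w: "on_wish P i c j v s = (s', out)"
  shows "view1_state P s'" "\<forall>(r, m)\<in>out. view1_msg P m"
proof -
  define mv where "mv = (if v > max_views s j then (max_views s)(j := v) else max_views s)"
  define w where "w = supported_view P (2 * max_faults P + 1) mv"
  define w' where "w' = supported_view P (max_faults P + 1) mv"
  have mv: "\<forall>l. mv l \<le> 1" using s v by (auto simp: mv_def view1_state_def)
  have ww: "w \<le> w'" "w' \<le> 1" using supported_view_le_plus[OF mv] by (auto simp: w_def w'_def)
  have "{l \<in> procs P. 1 \<le> max_views s l} \<subseteq> {l \<in> procs P. 1 \<le> mv l}" by (auto simp: mv_def)
  then have "card {l \<in> procs P. 1 \<le> max_views s l} \<le> card {l \<in> procs P. 1 \<le> mv l}"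
    by (intro card_mono) auto
  then have mono: "view s \<le> w"
    using s supported_view_binary[OF mv, of "2 * max_faults P + 1" P]
      supported_view_binary[of "max_views s" "2 * max_faults P + 1" P]
    by (simp add: view1_state_def w_def card_procs)
  \<comment> \<open>The simplifier turns \<open>n + 1\<close> into \<open>Suc n\<close>, so the
    abbreviations are recorded in that form too.\<close>
  have sup: "supported_view P (Suc (2 * max_faults P)) mv = w"
    "supported_view P (Suc (max_faults P)) mv = w'" by (simp_all add: w_def w'_def)
  have on: "on_wish P i c j v s =
     (let s1 = s\<lparr>max_views := mv, view := w, view_plus := w'\<rparr>;
          wishes = (if w' > view_plus s then to_all P (Wish w') else {})
      in if w' = w \<and> w > view s
         then (enter_view w (s1\<lparr>timer_view := Some (c + view_timeout P w)\<rparr>),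
               enter_msgs P i w s1 \<union> wishes)
         else (s1, wishes))"
    by (simp add: on_wish_def mv_def w_def w'_def Let_def)
  have "view1_state P s' \<and> (\<forall>(r, m)\<in>out. view1_msg P m)"
  proof (cases "w > view s")
    case True
    with ww have "w = 1" "w' = 1" "view s = 0" by auto
    with True on w s mv show ?thesis
      by (auto simp: view1_state_def enter_view_def sup Let_def
          enter_msgs_def view1_msg_def view1_proposal_def split: if_splits)
  next
    case False
    with mono have "w = view s" by simp
    with False on w s mv ww show ?thesis
      by (auto simp: view1_state_def sup Let_def view1_msg_def
          split: if_splits)
  qed
  then show "view1_state P s'" "\<forall>(r, m)\<in>out. view1_msg P m" by auto
qed

lemma inbox_store: "inbox (store m s) \<subseteq> insert m (inbox s)"
  by (auto simp: store_def Let_def)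

text \<open>Such a message would need \<open>nl_pre m < 0\<close>, and a quorum is nonempty. This is
  what stops \<open>Lead\<close> before any view is entered: with truncated subtraction
  \<open>leader P 0\<close> is process 1, and the handler itself only excludes view 1.\<close>

lemma no_newleader_quorum_0: "\<not> valid_newleader_quorum P 0 M"
proof
  assume "valid_newleader_quorum P 0 M"
  then obtain Q where Q: "quorum P Q" "bij_betw nl_signer M Q"
    and M: "\<forall>m\<in>M. valid_newleader P m \<and> nl_for m = 0"
    by (auto simp: valid_newleader_quorum_def)
  have "M \<noteq> {}" using Q by (auto simp: quorum_def bij_betw_def)
  with M show False by (auto simp: valid_newleader_def)
qed

lemma store_simps [simp]:
  "max_views (store m s) = max_views s" "view (store m s) = view s"
  "view_plus (store m s) = view_plus s" "curr_view (store m s) = curr_view s"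
  "timer_view (store m s) = timer_view s" "voted (store m s) = voted s"
  "curr_val (store m s) = curr_val s" "fired (store m s) = fired s"
  by (auto simp: store_def Let_def)

text \<open>Given admissible incoming messages, a view timeout is the only step that could break the
  invariant: in view 1 it disables the timer and asks for view 2. Retransmission uses
  \<open>view s + 1\<close> only without a timer, hence in view 0, where it yields
  \<open>Wish 1\<close>.\<close>

lemma step_view1:
  assumes "step P i c s e s' out" and s: "view1_state P s" and "e \<noteq> View_Timeout"
    and "\<And>j m. e = Receive j m \<Longrightarrow> view1_msg P m"
  shows "view1_state P s' \<and> (\<forall>(r, m)\<in>out. view1_msg P m)"
  using assms(1)
proof cases
  case (receive_wish j v)
  with assms(4) have "v \<le> 1" by (auto simp: view1_msg_def)
  with on_wish_view1[OF s] receive_wish show ?thesis by blast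
next
  case (receive m j)
  then show ?thesis using s assms(4)[of j m] inbox_store[of m s] by (auto simp: view1_state_def)
next
  case (lead v M x)
  have "v = 0" using lead(4,5) view1_state_bounds(3)[OF s] s by (simp add: view1_state_def)
  with lead(9) show ?thesis using no_newleader_quorum_0 by blast
next
  case (vote j v x M)
  have "view1_msg P (Propose j v x M)" using vote(4) s by (simp add: view1_state_def)
  then have "v = 1" and x: "x = Some (myval P (leader P 1))"
    by (simp_all add: view1_msg_def view1_proposal_def)
  then have "view1_msg P (Prepared (PREPARED i v (hash P x)))"
    by (auto simp: view1_msg_def view1_vote_def)
  moreover have "view1_state P s'" using vote(2,6) s x by (simp add: view1_state_def)
  ultimately show ?thesis using vote(3) by auto
next
  case start
  then show ?thesis using s by (auto simp: view1_msg_def)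
next
  case resend
  have "view_plus s \<le> 1" and "timer_view s = None \<Longrightarrow> view s = 0"
    using s view1_state_bounds[OF s] by (auto simp: view1_state_def)
  then have "\<forall>(r, m)\<in>out. view1_msg P m"
    using resend(3) by (auto simp: view1_msg_def to_all_def)
  moreover have "view1_state P s'" using resend(2) s by (simp add: view1_state_def)
  ultimately show ?thesis by simp
next
  case (lock d Q v h)
  then show ?thesis using s by (auto simp: view1_state_def view1_msg_def to_all_def)
qed (use assms in \<open>auto simp: view1_state_def\<close>)

section \<open>Effects of single steps\<close>

lemma on_wish_effect:
  assumes "on_wish P i c j v s = (s', out)"
  shows "max_views s' = (if v > max_views s j then (max_views s)(j := v) else max_views s)"
    and "inbox s' = inbox s" and "fired s' = fired s"
    and "view_plus s' > view_plus s \<Longrightarrow> to_all P (Wish (view_plus s')) \<subseteq> out"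
    and "(r, Wish u) \<in> out \<Longrightarrow> to_all P (Wish u) \<subseteq> out"
  using assms
  by (auto simp: on_wish_def Let_def enter_view_def enter_msgs_def split: if_splits)

lemma on_wish_enter:
  assumes "on_wish P i c j v s = (s', out)"
  obtains (stay) "timer_view s' = timer_view s" "curr_view s' = curr_view s" "voted s' = voted s"
  | (enter) "curr_view s' = view s'" "view s' > view s" "voted s' = Some False"
      "timer_view s' = Some (c + view_timeout P (view s'))"
      "view s' = 1 \<Longrightarrow> i = leader P 1 \<Longrightarrow> to_all P (view1_proposal P) \<subseteq> out"
  using assms
  by (auto simp: on_wish_def Let_def enter_view_def enter_msgs_def view1_proposal_def split: if_splits)

lemma step_max_views:
  assumes "step P i c s e s' out"
  shows "max_views s j \<le> max_views s' j"
  using assms by cases (auto dest: on_wish_effect(1))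

lemma step_max_views_less:
  assumes "step P i c s e s' out" and "max_views s j < max_views s' j"
  shows "e = Receive j (Wish (max_views s' j))"
  using assms by cases (auto dest: on_wish_effect(1) split: if_splits)

lemma step_wish_received:
  assumes "step P i c s (Receive j (Wish v)) s' out"
  shows "v \<le> max_views s' j"
  using assms by cases (auto dest: on_wish_effect(1))

lemma step_view_plus:
  assumes "step P i c s e s' out" and "view_plus s < view_plus s'"
  shows "to_all P (Wish (view_plus s')) \<subseteq> out"
  using assms by cases (auto dest: on_wish_effect(4))

lemma step_wish_to_all:
  assumes "step P i c s e s' out" and "(r, Wish v) \<in> out"
  shows "to_all P (Wish v) \<subseteq> out"
  using assms by cases (auto dest: on_wish_effect(5) split: if_splits)

text \<open>Traces a running timer back to the step that set it, which is an entry into a view; the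
  clock reading at that step determines the expiry.\<close>

lemma step_timer_view:
  assumes "step P i c s e s' out" and "timer_view s' = Some d" and "timer_view s \<noteq> Some d"
  shows "d = c + view_timeout P (curr_view s') \<and> view s' = curr_view s' \<and> 0 < curr_view s'"
  using assms(1)
proof cases
  case (receive_wish j v)
  from receive_wish(2) show ?thesis
    by (cases rule: on_wish_enter) (use assms in auto)
qed (use assms in auto)

lemma step_leader_enters:
  assumes "step P i c s e s' out" and "curr_view s \<noteq> 1" and "curr_view s' = 1"
    and "i = leader P 1"
  shows "to_all P (view1_proposal P) \<subseteq> out"
  using assms(1)
proof cases
  case (receive_wish j v)
  from receive_wish(2) show ?thesis
    by (cases rule: on_wish_enter) (use assms in auto)
qed (use assms in auto)

lemma step_voted:
  assumes "step P i c s e s' out" and "view1_state P s" and "voted s \<noteq> Some True"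
    and "voted s' = Some True"
  shows "to_all P (view1_vote P i) \<subseteq> out"
  using assms(1)
proof cases
  case (receive_wish j v)
  from receive_wish(2) show ?thesis
    by (cases rule: on_wish_enter) (use assms in auto)
next
  case (vote j v x M)
  have "view1_msg P (Propose j v x M)" using vote(4) assms(2) by (simp add: view1_state_def)
  then have "v = 1" and "x = Some (myval P (leader P 1))"
    by (simp_all add: view1_msg_def view1_proposal_def)
  with vote(3) show ?thesis by (simp add: view1_vote_def)
qed (use assms in auto)

text \<open>The flag is set by the fast path alone, so finding it in a state certifies a past
  decision.\<close>

lemma step_fired_fast:
  assumes "step P i c s e s' out" and "(H_Fast, v) \<in> fired s'" and "(H_Fast, v) \<notin> fired s"
  shows "\<exists>x. e = Decide x"
  using assms by cases (auto dest: on_wish_effect(3))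

text \<open>
  The buffer never replaces a proposal or a vote by another one, since each signer has only one.
\<close>

lemma store_view1:
  assumes "view1_state P s" and "view1_msg P m" and "msg_kind m \<in> {K_Propose, K_Prepared}"
  shows "inbox (store m s) = insert m (inbox s)"
proof -
  have "m' = m" if "m' \<in> inbox s" "msg_kind m' = msg_kind m" "same_signer m' m" for m'
  proof -
    have "view1_msg P m'" using that(1) assms(1) by (simp add: view1_state_def)
    with assms(2,3) that(2,3) show ?thesis
      by (auto simp: view1_msg_def view1_proposal_def view1_vote_def)
  qed
  then show ?thesis by (auto simp: store_def Let_def)
qed

lemma store_other_kind:
  "m' \<in> inbox s \<Longrightarrow> msg_kind m' \<noteq> msg_kind m \<Longrightarrow> m' \<in> inbox (store m s)"
  by (auto simp: store_def Let_def)

lemma step_received: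
  assumes "step P i c s (Receive j m) s' out" and "view1_state P s" and "view1_msg P m"
    and "msg_kind m \<in> {K_Propose, K_Prepared}"
  shows "m \<in> inbox s'"
  using assms(1) by cases (use assms store_view1[OF assms(2-4)] in auto)

text \<open>Wishes bypass the buffer, a message of another kind evicts nothing of this kind, and one
  of the same kind is harmless by \<open>store_view1\<close>.\<close>

lemma step_inbox_mono:
  assumes "step P i c s e s' out" and "view1_state P s"
    and "\<And>j m. e = Receive j m \<Longrightarrow> view1_msg P m"
    and "m' \<in> inbox s" and "msg_kind m' \<in> {K_Propose, K_Prepared}"
  shows "m' \<in> inbox s'"
  using assms(1)
proof cases
  case (receive_wish j v)
  then show ?thesis using assms(4) on_wish_effect(2) by metis
next
  case (receive m j)
  then show ?thesis
    using assms store_view1[of P s m] store_other_kind[of m' s m] by (cases "msg_kind m' = msg_kind m") auto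
qed (use assms in auto)

section \<open>Quiescence before the first \<open>Start\<close>\<close>

definition idle :: "('v, 'h) pstate \<Rightarrow> bool" where
  "idle s \<longleftrightarrow> (\<forall>j. max_views s j = 0) \<and> view_plus s = 0 \<and> timer_view s = None \<and>
     curr_view s = 0 \<and> voted s = None \<and> timer_fast_path s = None \<and> inbox s = {}"

lemma idle_init: "idle (init_pstate a)"
  by (simp add: idle_def init_pstate_def)

text \<open>Retransmission may still run, but without a timer and with \<open>max_views\<close> zero
  it sends nothing; this is why \<open>idle\<close> leaves \<open>resend_at\<close> free. Every
  other handler needs a timer or a buffered message.\<close>

lemma step_idle:
  assumes "step P i c s e s' out" and "idle s" and "e \<noteq> Start" and "\<And>j m. e \<noteq> Receive j m"
  shows "idle s' \<and> out = {}"
  using assms(1)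
proof cases
  case (lead v M x)
  then show ?thesis using assms(2) no_newleader_quorum_0 by (auto simp: idle_def)
next
  \<comment> \<open>\<open>locked_view\<close> and \<open>curr_view\<close> may both be 0 here, so
    it is the empty inbox against a nonempty quorum that rules this case out.\<close>
  case (decide_slow Q v h x)
  then show ?thesis using assms(2) by (auto simp: idle_def quorum_def)
qed (use assms in \<open>auto simp: idle_def\<close>)

section \<open>Executions without faults that start after \<open>GST\<close>\<close>

locale view1_run =
  fixes P :: "('v, 'h) protocol" and R :: "('v, 'h) execution"
  assumes wf_P: "wf_protocol P"
    and run: "execution_of P R"
    and all_correct: "correct P R = procs P"
    and start_after_GST: "GST R \<le> S_first P R"
    and long_timeout: "4 * delta R < view_timeout P 1"
begin

lemma actor_in_procs: "actor R k \<in> procs P"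
  using run by (simp add: execution_of_def)

lemma time_mono: "k \<le> l \<Longrightarrow> time R k \<le> time R l"
  using run by (auto simp: execution_of_def wf_times_def mono_def)

lemma time_nonneg: "0 \<le> time R k"
  using time_mono[of 0 k] run by (simp add: execution_of_def wf_times_def)

lemma delta_nonneg: "0 \<le> delta R"
  using run by (simp add: execution_of_def wf_times_def)

lemma init_state:
  assumes "i \<in> procs P"
  shows "\<exists>a. pstates R 0 i = init_pstate a"
proof -
  have "correct_steps P R" using run by (simp add: execution_of_def)
  with assms show ?thesis unfolding correct_steps_def all_correct by blast
qed

lemma step_at:
  "step P (actor R k) (clock R (actor R k) (time R k)) (pstates R k (actor R k)) (event R k)
     (pstates R (Suc k) (actor R k)) (sent R k)"
proof -
  have "correct_steps P R" using run by (simp add: execution_of_def)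
  with actor_in_procs show ?thesis unfolding correct_steps_def all_correct by metis
qed

lemma state_unchanged: "i \<in> procs P \<Longrightarrow> i \<noteq> actor R k \<Longrightarrow> pstates R (Suc k) i = pstates R k i"
proof -
  assume "i \<in> procs P" "i \<noteq> actor R k"
  moreover have "correct_steps P R" using run by (simp add: execution_of_def)
  ultimately show ?thesis unfolding correct_steps_def all_correct by metis
qed

text \<open>Only its own steps change the state of a process. This leads from facts about states
  back to events: whatever holds now but not initially was brought about by an identifiable
  step.\<close>

lemma becomes_true:
  assumes "i \<in> procs P" and "A (pstates R k i)" and "\<not> A (pstates R 0 i)"
  obtains l where "l < k" "actor R l = i" "\<not> A (pstates R l i)" "A (pstates R (Suc l) i)"
proof -
  have "\<exists>l<k. actor R l = i \<and> \<not> A (pstates R l i) \<and> A (pstates R (Suc l) i)"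
    using assms(2)
  proof (induction k)
    case 0
    with assms(3) show ?case by simp
  next
    case (Suc k)
    show ?case
    proof (cases "A (pstates R k i)")
      case True
      with Suc.IH show ?thesis using less_SucI by blast
    next
      case False
      with Suc.prems have "actor R k = i" using state_unchanged[OF assms(1), of k] by metis
      with False Suc.prems show ?thesis by blast
    qed
  qed
  with that show ?thesis by blast
qed

lemma stays_true:
  assumes "i \<in> procs P" and "k \<le> k'" and "A (pstates R k i)"
    and "\<And>l. l < k' \<Longrightarrow> actor R l = i \<Longrightarrow> A (pstates R l i) \<Longrightarrow> A (pstates R (Suc l) i)"
  shows "A (pstates R k' i)"
  using assms(2,4)
proof (induction k' rule: dec_induct)
  case base
  then show ?case using assms(3) by simp
next
  case (step n)
  have "A (pstates R n i)" using step by simp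
  then show ?case using step.prems[of n] state_unchanged[OF assms(1), of n] by (metis lessI)
qed

lemma received_was_sent:
  assumes "event R k = Receive j m"
  shows "origin R k < k \<and> actor R (origin R k) = j \<and> (actor R k, m) \<in> sent R (origin R k)"
proof -
  have "partially_synchronous_links P R" using run by (simp add: execution_of_def)
  with assms actor_in_procs show ?thesis
    unfolding partially_synchronous_links_def all_correct by blast
qed

lemma start_event:
  assumes "i \<in> procs P"
  obtains k where "actor R k = i" "event R k = Start" "start_time R i = time R k"
proof -
  have "\<exists>!k. actor R k = i \<and> event R k = Start"
    using run assms by (simp add: execution_of_def starts_once_def all_correct)
  from theI'[OF this] show ?thesis using that unfolding start_time_def by blast
qed

lemma start_after_GST_at:
  assumes "event R k = Start"
  shows "GST R \<le> time R k"
proof -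
  have "\<exists>!k. actor R k = actor R k' \<and> event R k = Start" for k'
    using run actor_in_procs by (simp add: execution_of_def starts_once_def all_correct)
  then obtain l where "actor R l = actor R k" "event R l = Start" "start_time R (actor R k) = time R l"
    and "l = k"
    using start_event[OF actor_in_procs] assms by metis
  then have "S_first P R \<le> time R k"
    unfolding S_first_def all_correct using actor_in_procs[of k]
    by (intro Min_le) (auto intro: rev_image_eqI)
  with start_after_GST show ?thesis by simp
qed

lemma start_before_S_last:
  assumes "i \<in> procs P"
  shows "start_time R i \<le> S_last P R"
  unfolding S_last_def all_correct using assms by simp

text \<open>Links deliver only what was sent, so as long as nobody starts there is nothing to
  receive and idleness persists. As the first start is not before \<open>GST\<close>, every message
  is then subject to the delay bound, and every timer runs on a drift-free clock.\<close>

lemma idle_before_start: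
  assumes "\<forall>l<k. event R l \<noteq> Start"
  shows "(\<forall>i\<in>procs P. idle (pstates R k i)) \<and> (\<forall>l<k. sent R l = {})"
  using assms
proof (induction k)
  case 0
  then show ?case using idle_init init_state by (metis not_less_zero)
next
  case (Suc k)
  then have idle: "\<forall>i\<in>procs P. idle (pstates R k i)" and empty: "\<forall>l<k. sent R l = {}" by auto
  have "event R k \<noteq> Receive j m" for j m
    using received_was_sent[of k j m] empty by auto
  with step_idle[OF step_at] idle actor_in_procs Suc.prems
  have "idle (pstates R (Suc k) (actor R k)) \<and> sent R k = {}" by blast
  with idle empty state_unchanged show ?case by (metis less_SucE)
qed

lemma sent_after_GST:
  assumes "sent R k \<noteq> {}"
  shows "GST R \<le> time R k"
proof -
  \<comment> \<open>The bound is \<open>Suc k\<close> because step \<open>k\<close> may itself be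
    the first \<open>Start\<close>.\<close>
  have "\<exists>l<Suc k. event R l = Start" using idle_before_start[of "Suc k"] assms by blast
  then show ?thesis using start_after_GST_at time_mono by (meson less_Suc_eq_le order_trans)
qed

lemma active_after_GST:
  assumes "i \<in> procs P" and "\<not> idle (pstates R (Suc k) i)"
  shows "GST R \<le> time R k"
proof -
  have "\<exists>l<Suc k. event R l = Start" using idle_before_start[of "Suc k"] assms by blast
  then show ?thesis using start_after_GST_at time_mono by (meson less_Suc_eq_le order_trans)
qed

lemma delivered:
  assumes "(i, m) \<in> sent R l" and "i \<in> procs P"
  obtains k where "actor R k = i" "event R k = Receive (actor R l) m"
    "time R k \<le> time R l + delta R"
proof -
  have "partially_synchronous_links P R" using run by (simp add: execution_of_def)
  moreover have "GST R \<le> time R l" using sent_after_GST assms(1) by auto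
  ultimately show ?thesis using assms actor_in_procs that
    unfolding partially_synchronous_links_def all_correct by metis
qed

section \<open>The invariant as long as no view timer can have expired\<close>

text \<open>Early steps precede the first possible expiry of a view timer.\<close>

definition early :: "nat \<Rightarrow> bool" where
  "early k \<longleftrightarrow>
     (\<forall>l<k. (\<exists>i\<in>procs P. 0 < curr_view (pstates R (Suc l) i)) \<longrightarrow>
        time R k < time R l + view_timeout P 1)"

text \<open>An expiring timer was set on entering some view \<open>v \<ge> 1\<close>, for a duration
  of at least \<open>view_timeout P 1\<close> by monotonicity. Clocks do not drift after
  \<open>GST\<close>, so at least that much real time has passed since the entry, which
  \<open>early\<close> forbids.\<close>

lemma no_early_timeout:
  assumes "early k"
  shows "event R k \<noteq> View_Timeout"
proof
  let ?i = "actor R k"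
  assume "event R k = View_Timeout"
  then obtain d where d: "timer_view (pstates R k ?i) = Some d" "d \<le> clock R ?i (time R k)"
    using step_at[of k] by (auto elim: step.cases)
  moreover have "timer_view (pstates R 0 ?i) \<noteq> Some d"
    using init_state[OF actor_in_procs[of k]] by (auto simp: init_pstate_def)
  ultimately obtain l where l: "l < k" "actor R l = ?i" "timer_view (pstates R l ?i) \<noteq> Some d"
    "timer_view (pstates R (Suc l) ?i) = Some d"
    using becomes_true[OF actor_in_procs[of k], of "\<lambda>s. timer_view s = Some d" k] by blast
  let ?v = "curr_view (pstates R (Suc l) ?i)"
  have v: "d = clock R ?i (time R l) + view_timeout P ?v" "0 < ?v"
    using step_timer_view[OF step_at[of l]] l by auto
  have F: "view_timeout P 1 \<le> view_timeout P ?v"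
    using wf_P v(2) by (auto simp: wf_protocol_def mono_def)
  \<comment> \<open>A process with a running timer is not idle, so the step that set it is not
    before \<open>GST\<close>.\<close>
  have "GST R \<le> time R l" using active_after_GST[OF actor_in_procs[of k], of l] l(4) by (auto simp: idle_def)
  moreover have "time R l \<le> time R k" using time_mono l(1) by simp
  moreover have "wf_clocks P R" using run by (simp add: execution_of_def)
  ultimately have "clock R ?i (time R k) - clock R ?i (time R l) = time R k - time R l"
    using actor_in_procs[of k] unfolding wf_clocks_def all_correct by blast
  moreover have "time R k < time R l + view_timeout P 1"
    using assms l(1) v(2) actor_in_procs[of k] unfolding early_def by blast
  ultimately show False using v(1) d(2) F by linarith
qed

text \<open>States and messages need a joint induction: a process keeps the invariant because of
  what it receives, and messages obey it because of the states of their senders. Earliness enters by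
  excluding view timeouts.\<close>

lemma view1_invariant:
  assumes "\<forall>l<k. early l"
  shows "(\<forall>i\<in>procs P. view1_state P (pstates R k i)) \<and>
    (\<forall>l<k. \<forall>(j, m)\<in>sent R l. view1_msg P m)"
  using assms
proof (induction k)
  case 0
  then show ?case using view1_state_init init_state by (metis not_less_zero)
next
  case (Suc k)
  then have st: "\<forall>i\<in>procs P. view1_state P (pstates R k i)"
    and msg: "\<forall>l<k. \<forall>(j, m)\<in>sent R l. view1_msg P m" by auto
  have "view1_msg P m" if "event R k = Receive j m" for j m
    using received_was_sent[OF that] msg by blast
  with step_view1[OF step_at] st actor_in_procs no_early_timeout Suc.prems
  have "view1_state P (pstates R (Suc k) (actor R k)) \<and> (\<forall>(j, m)\<in>sent R k. view1_msg P m)"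
    by blast
  with st msg state_unchanged show ?case by (metis less_SucE)
qed

section \<open>Real time and step indices\<close>

definition steps_until :: "real \<Rightarrow> nat" where
  "steps_until t = (LEAST k. t < time R k)"

text \<open>Times are monotone and unbounded, so the steps up to time \<open>t\<close> form a finite
  initial segment. Several steps may share the time \<open>t\<close>; the state at
  \<open>steps_until t\<close> is the one after all of them.\<close>

lemma less_steps_until: "l < steps_until t \<longleftrightarrow> time R l \<le> t"
proof -
  obtain k where "t < time R k" using run unfolding execution_of_def wf_times_def by blast
  then have "t < time R (steps_until t)" unfolding steps_until_def by (rule LeastI)
  then show ?thesis
    using time_mono[of "steps_until t" l] not_less_Least[of l "\<lambda>k. t < time R k"]
    unfolding steps_until_def by (meson leD leI order_less_le_trans)
qed

text \<open>The source of progress: since no handler can be enabled at such a point, one whose other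
  preconditions hold must already have run.\<close>

lemma not_urgent:
  assumes "0 \<le> t" and "i \<in> procs P"
  shows "\<not> urgent P i (clock R i t) (pstates R (steps_until t) i)"
proof -
  have "zero_processing_time P R" using run by (simp add: execution_of_def)
  moreover have "t < time R (steps_until t)" using less_steps_until by (meson less_irrefl not_less)
  ultimately show ?thesis using assms less_steps_until
    unfolding zero_processing_time_def all_correct by blast
qed

text \<open>If somebody enters a view by \<open>S_last\<close>, the senders of the wishes counted at
  the first entry form \<open>Q\<close>; otherwise \<open>Q\<close> is everybody, since all have
  started. No view timer is set before \<open>T\<close>, and \<open>view_timeout P 1\<close> exceeds
  3\<delta>, hence the bound on early steps.\<close>

lemma first_wishes:
  obtains T Q where "0 \<le> T" "T \<le> S_last P R" "\<And>k. time R k \<le> T + 3 * delta R \<Longrightarrow> early k"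
    "Q \<subseteq> procs P" "2 * max_faults P + 1 \<le> card Q"
    "\<And>j. j \<in> Q \<Longrightarrow> \<exists>l. actor R l = j \<and> time R l \<le> T \<and> to_all P (Wish 1) \<subseteq> sent R l"
proof -
  let ?entered = "\<lambda>l. \<exists>i\<in>procs P. 0 < curr_view (pstates R (Suc l) i)"
  have init: "view_plus (pstates R 0 i) = 0" "max_views (pstates R 0 i) j = 0"
    if "i \<in> procs P" for i j
    using init_state[OF that] by (auto simp: init_pstate_def)
  show ?thesis
  proof (cases "\<exists>l. ?entered l \<and> time R l \<le> S_last P R")
    case True
    \<comment> \<open>The first entering step; being least in index, it is also least in
      time.\<close>
    define l where "l = (LEAST l. ?entered l \<and> time R l \<le> S_last P R)"
    have l: "?entered l" "time R l \<le> S_last P R"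
      using LeastI_ex[OF True] unfolding l_def by auto
    have first: "time R l \<le> time R l'" if "?entered l'" for l'
    proof (cases "time R l' \<le> S_last P R")
      case True
      with that have "l \<le> l'" unfolding l_def by (intro Least_le) simp
      then show ?thesis by (rule time_mono)
    qed (use l(2) in simp)
    have early: "early k" if "time R k \<le> time R l + 3 * delta R" for k
      unfolding early_def
    proof (intro allI impI)
      fix l' assume "?entered l'"
      from first[OF this] that show "time R k < time R l' + view_timeout P 1"
        using long_timeout delta_nonneg by linarith
    qed
    have early_upto: "\<forall>m<Suc n. early m" if "n \<le> l" for n
    proof (intro allI impI)
      fix m assume "m < Suc n"
      then have "time R m \<le> time R l" using that by (intro time_mono) simp
      then show "early m" using delta_nonneg by (intro early) simp
    qed
    obtain i where i: "i \<in> procs P" "0 < curr_view (pstates R (Suc l) i)" using l(1) by blast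
    let ?s = "pstates R (Suc l) i"
    let ?Q = "{j \<in> procs P. 1 \<le> max_views ?s j}"
    have s: "view1_state P ?s" using view1_invariant[of "Suc l"] early_upto i(1) by blast
    then have "0 < supported_view P (2 * max_faults P + 1) (max_views ?s)"
      using i(2) by (simp add: view1_state_def)
    then have Q: "2 * max_faults P + 1 \<le> card ?Q"
      using supported_view_binary[of "max_views ?s" "2 * max_faults P + 1" P] s
      by (simp add: view1_state_def card_procs split: if_splits)
    show ?thesis
    proof (rule that[of "time R l" ?Q])
      fix j assume "j \<in> ?Q"
      then obtain l' where l': "l' < Suc l" "actor R l' = i"
        "\<not> 1 \<le> max_views (pstates R l' i) j" "1 \<le> max_views (pstates R (Suc l') i) j"
        using becomes_true[OF i(1), of "\<lambda>s. 1 \<le> max_views s j" "Suc l"] init(2)[OF i(1)] by auto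
      \<comment> \<open>The invariant caps the entry at 1, so the wish that raised it was
        \<open>Wish 1\<close> and not one for a higher view; wishes are only ever sent to
        all.\<close>
      have "view1_state P (pstates R (Suc l') i)"
        using view1_invariant[of "Suc l'"] early_upto[of l'] l'(1) i(1) by simp
      then have "max_views (pstates R (Suc l') i) j = 1"
        using l'(4) by (auto simp: view1_state_def intro: le_antisym)
      then have "event R l' = Receive j (Wish 1)"
        using step_max_views_less[OF step_at[of l'], of j] l'(2,3) by simp
      from received_was_sent[OF this]
      have "origin R l' < l'" "actor R (origin R l') = j"
        "to_all P (Wish 1) \<subseteq> sent R (origin R l')"
        using step_wish_to_all[OF step_at] by blast+
      moreover have "time R (origin R l') \<le> time R l"
        using \<open>origin R l' < l'\<close> l'(1) by (intro time_mono) simp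
      ultimately show "\<exists>l''. actor R l'' = j \<and> time R l'' \<le> time R l \<and>
          to_all P (Wish 1) \<subseteq> sent R l''" by blast
    qed (use time_nonneg l(2) early Q in auto)
  next
    case False
    have early: "early k" if "time R k \<le> S_last P R + 3 * delta R" for k
      unfolding early_def
    proof (intro allI impI)
      fix l assume "?entered l"
      with False that show "time R k < time R l + view_timeout P 1"
        using long_timeout delta_nonneg by (smt (verit))
    qed
    show ?thesis
    proof (rule that[of "S_last P R" "procs P"])
      show "0 \<le> S_last P R"
        using start_before_S_last[OF leader_in_procs] start_event[OF leader_in_procs] time_nonneg
        by (metis order_trans)
    next
      fix j assume j: "j \<in> procs P"
      then obtain k where k: "actor R k = j" "event R k = Start" "start_time R j = time R k"
        using start_event by blast
      have Tk: "time R l \<le> S_last P R" if "l \<le> k" for l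
        using start_before_S_last[OF j] k(3) time_mono[OF that] by simp
      show "\<exists>l. actor R l = j \<and> time R l \<le> S_last P R \<and> to_all P (Wish 1) \<subseteq> sent R l"
      \<comment> \<open>\<open>Start\<close> sends nothing if \<open>view_plus\<close> is already
        positive; in that case an earlier rise of \<open>view_plus\<close> made the process send the
        same wish.\<close>
      proof (cases "view_plus (pstates R k j) = 0")
        case True
        with step_at[of k] k have "sent R k = to_all P (Wish 1)" by (auto elim: step.cases)
        with k(1) Tk show ?thesis by blast
      next
        case False
        then obtain l where l: "l < k" "actor R l = j" "\<not> 0 < view_plus (pstates R l j)"
          "0 < view_plus (pstates R (Suc l) j)"
          using becomes_true[OF j, of "\<lambda>s. 0 < view_plus s" k] init(1)[OF j] by auto
        have "\<forall>m<Suc l. early m"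
          using l(1) Tk early delta_nonneg by (smt (verit) less_Suc_eq_le less_imp_le order_trans)
        then have "view1_state P (pstates R (Suc l) j)" using view1_invariant j by blast
        then have "view_plus (pstates R (Suc l) j) = 1" using view1_state_bounds(2) l(4) by fastforce
        then have "to_all P (Wish 1) \<subseteq> sent R l"
          using step_view_plus[OF step_at[of l]] l(2,3) by simp
        with l(1,2) Tk[of l] show ?thesis by auto
      qed
    qed (use early in \<open>auto simp: card_procs\<close>)
  qed
qed

lemma fast_decision:
  assumes i: "i \<in> procs P"
  shows "\<exists>x t. decides_at R i x t \<and> t \<le> S_last P R + 3 * delta R"
proof -
  obtain T Q where T: "0 \<le> T" "T \<le> S_last P R"
    and early: "\<And>k. time R k \<le> T + 3 * delta R \<Longrightarrow> early k"
    and Q: "Q \<subseteq> procs P" "2 * max_faults P + 1 \<le> card Q"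
    and wishes: "\<And>j. j \<in> Q \<Longrightarrow>
      \<exists>l. actor R l = j \<and> time R l \<le> T \<and> to_all P (Wish 1) \<subseteq> sent R l"
    using first_wishes by metis
  define d where "d = delta R"
  have d: "0 \<le> d" using delta_nonneg by (simp add: d_def)
  define st where "st t = pstates R (steps_until t)" for t
  have all_early: "\<forall>l<k. early l" if "k \<le> steps_until (T + 3 * d)" for k
    using that early less_steps_until[of _ "T + 3 * d"] unfolding d_def
    by (meson order_less_le_trans)
  have inv: "view1_state P (pstates R k p)" if "p \<in> procs P" "k \<le> steps_until (T + 3 * d)" for k p
    using view1_invariant[OF all_early] that by blast
  have inv_msg: "view1_msg P m" if "(j, m) \<in> sent R l" "l < steps_until (T + 3 * d)" for j m l
    using view1_invariant[OF all_early[OF order_refl]] that by blast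
  have until_mono: "steps_until t \<le> steps_until t'" if "t \<le> t'" for t t'
    using less_steps_until that by (meson not_le order_trans less_irrefl)
  have inv_at: "view1_state P (st t p)" if "p \<in> procs P" "t \<le> T + 3 * d" for p t
    using inv that until_mono unfolding st_def by blast
  \<comment> \<open>The wishes of \<open>Q\<close> have arrived by \<open>T + d\<close>, entries of
    \<open>max_views\<close> never decrease, and the invariant turns their count into
    \<open>view = 1\<close> and thus \<open>curr_view = 1\<close>.\<close>
  have in_view1: "curr_view (st t p) = 1" if p: "p \<in> procs P" and t: "T + d \<le> t" "t \<le> T + 3 * d" for p t
  proof -
    have "1 \<le> max_views (st t p) j" if "j \<in> Q" for j
    proof -
      obtain l where l: "actor R l = j" "time R l \<le> T" "(p, Wish 1) \<in> sent R l"
        using wishes[OF \<open>j \<in> Q\<close>] p unfolding to_all_def by blast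
      obtain k where k: "actor R k = p" "event R k = Receive j (Wish 1)" "time R k \<le> T + d"
        using delivered[OF l(3) p] l(1,2) unfolding d_def by (metis add_mono_thms_linordered_semiring(3) order_trans)
      have "Suc k \<le> steps_until t" using k(3) t(1) less_steps_until[of k t] by simp
      moreover have "1 \<le> max_views (pstates R (Suc k) p) j"
        using step_wish_received step_at[of k] k by metis
      ultimately show ?thesis unfolding st_def
        by (rule stays_true[OF p, where A = "\<lambda>s. 1 \<le> max_views s j"])
          (metis step_max_views[OF step_at] order_trans)
    qed
    then have "card Q \<le> card {j \<in> procs P. 1 \<le> max_views (st t p) j}"
      using Q(1) by (intro card_mono) auto
    with Q(2) inv_at[OF p t(2)] show ?thesis
      using supported_view_binary[of "max_views (st t p)" "2 * max_faults P + 1" P]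
      by (simp add: view1_state_def card_procs)
  qed
  \<comment> \<open>Buffered proposals and votes are never evicted, so a broadcast stays visible
    from \<open>d\<close> after its sending.\<close>
  have received: "m \<in> inbox (st t p)"
    if p: "p \<in> procs P" and m: "msg_kind m \<in> {K_Propose, K_Prepared}"
      and sent: "to_all P m \<subseteq> sent R l" and t: "time R l + d \<le> t" "t \<le> T + 3 * d" for m l t p
  proof -
    obtain k where k: "actor R k = p" "event R k = Receive (actor R l) m" "time R k \<le> time R l + d"
      using delivered[of p m l] sent p unfolding d_def to_all_def by blast
    have k_until: "Suc k \<le> steps_until t" using k(3) t(1) less_steps_until[of k t] by simp
    have ok: "view1_msg P m'" if "event R k' = Receive j m'" "k' < steps_until t" for k' j m'
      
      using received_was_sent[OF that(1)] inv_msg[of _ m' "origin R k'"] that(2) until_mono[OF t(2)]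
      by fastforce
    have view1: "view1_state P (pstates R k' p)" if "k' < steps_until t" for k'
      using inv[OF p] that until_mono[OF t(2)] by simp
    have "m \<in> inbox (pstates R (Suc k) p)"
      using step_received[of P p _ _ "actor R l" m] step_at[of k] k(1,2) view1[of k] ok[OF k(2)] m k_until
      by (metis Suc_le_eq)
    with k_until show ?thesis unfolding st_def
    proof (rule stays_true[OF p, where A = "\<lambda>s. m \<in> inbox s"])
      fix k' assume k': "k' < steps_until t" "actor R k' = p" "m \<in> inbox (pstates R k' p)"
      show "m \<in> inbox (pstates R (Suc k') p)"
        using step_inbox_mono[OF step_at[of k'], of m] k' view1[OF k'(1)] ok[OF _ k'(1)] m by simp
    qed
  qed
  have not_initially: "curr_view (pstates R 0 p) \<noteq> 1" "voted (pstates R 0 p) \<noteq> Some True"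
    "(H_Fast, 1) \<notin> fired (pstates R 0 p)" if "p \<in> procs P" for p
    using init_state[OF that] by (auto simp: init_pstate_def)
  obtain l where l: "l < steps_until (T + d)" "to_all P (view1_proposal P) \<subseteq> sent R l"
  proof -
    have "curr_view (st (T + d) (leader P 1)) = 1"
      using in_view1[OF leader_in_procs] d by simp
    then obtain l where "l < steps_until (T + d)" "actor R l = leader P 1"
      "curr_view (pstates R l (leader P 1)) \<noteq> 1" "curr_view (pstates R (Suc l) (leader P 1)) = 1"
      using becomes_true[OF leader_in_procs[of P 1], of "\<lambda>s. curr_view s = 1"]
        not_initially(1)[OF leader_in_procs[of P 1]] unfolding st_def by blast
    then show ?thesis using that step_leader_enters[OF step_at[of l]] by metis
  qed
  have voted: "voted (st t p) = Some True" if p: "p \<in> procs P" and t: "T + 2 * d \<le> t" "t \<le> T + 3 * d" for p t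
  proof -
    have "view1_proposal P \<in> inbox (st t p)"
      using received[OF p _ l(2)] l(1) t less_steps_until[of l "T + d"]
      by (simp add: view1_proposal_def)
    moreover have view: "curr_view (st t p) = 1" using in_view1[OF p] t d by simp
    moreover have "safe_proposal P (leader P 1) 1 (Some (myval P (leader P 1))) {}"
      using run leader_in_procs[of P 1] by (simp add: safe_proposal_def execution_of_def all_correct)
    \<comment> \<open>With the proposal buffered and no vote cast, \<open>Vote\<close> would be
      enabled. The value \<open>None\<close> is excluded next, because view 1 has been
      entered.\<close>
    ultimately have "voted (st t p) \<noteq> Some False"
      using not_urgent[of t p] p t T(1) d step.vote[of "leader P 1" 1 _ "{}" "st t p" P]
      unfolding urgent_def st_def view1_proposal_def by (smt (verit) event.distinct)
    moreover have "voted (st t p) \<noteq> None"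
      using inv_at[OF p t(2)] view by (simp add: view1_state_def)
    ultimately show ?thesis by auto
  qed
  let ?t = "T + 3 * d"
  let ?x = "myval P (leader P 1)"
  have "view1_vote P j \<in> inbox (st ?t i)" if j: "j \<in> procs P" for j
  proof -
    have "voted (st (T + 2 * d) j) = Some True" using voted[OF j] d by simp
    then obtain l where l: "l < steps_until (T + 2 * d)" "actor R l = j"
      "voted (pstates R l j) \<noteq> Some True" "voted (pstates R (Suc l) j) = Some True"
      using becomes_true[OF j, of "\<lambda>s. voted s = Some True"] not_initially(2)[OF j]
      unfolding st_def by blast
    have "view1_state P (pstates R l j)" using inv[OF j, of l] l(1) until_mono[of "T + 2 * d" ?t] d by simp
    then have "to_all P (view1_vote P j) \<subseteq> sent R l"
      using step_voted[OF step_at[of l]] l(2-4) by simp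
    then show ?thesis
      using received[OF i, of "view1_vote P j" l ?t] l(1) less_steps_until[of l "T + 2 * d"]
      by (simp add: view1_vote_def)
  qed
  moreover have "voted (st ?t i) = Some True" using voted[OF i] d by simp
  moreover have "curr_view (st ?t i) = 1" using in_view1[OF i] d by simp
  moreover have "curr_val (st ?t i) = Some ?x"
    using inv_at[OF i, of ?t] \<open>voted (st ?t i) = Some True\<close> by (simp add: view1_state_def)
  \<comment> \<open>The clock reading \<open>c\<close> is arbitrary, as the fast path waits for no
    timer. All votes are present, so only a fast path already executed can keep the process from
    being urgent.\<close>
  ultimately have "(H_Fast, 1) \<notin> fired (st ?t i) \<Longrightarrow> urgent P i c (st ?t i)" for c
    using step.decide_fast[of P 1 "hash P (Some ?x)" "st ?t i" ?x i c]
    unfolding urgent_def view1_vote_def by (metis event.distinct)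
  then have "(H_Fast, 1) \<in> fired (st ?t i)"
    using not_urgent[of ?t i] i T(1) d unfolding st_def by fastforce
  then obtain l where l: "l < steps_until ?t" "actor R l = i"
    "(H_Fast, 1) \<notin> fired (pstates R l i)" "(H_Fast, 1) \<in> fired (pstates R (Suc l) i)"
    using becomes_true[OF i, of "\<lambda>s. (H_Fast, 1) \<in> fired s"] not_initially(3)[OF i]
    unfolding st_def by blast
  then obtain x where "event R l = Decide x" using step_fired_fast[OF step_at[of l]] by metis
  with l(2) have "decides_at R i x (time R l)" by (auto simp: decides_at_def)
  moreover have "time R l \<le> S_last P R + 3 * delta R"
    using l(1) less_steps_until[of l ?t] T(2) by (simp add: d_def)
  ultimately show ?thesis by blast
qed

end

theorem corollary64:
  fixes P :: "('v, 'h) protocol" and R :: "('v, 'h) execution"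
  assumes "wf_protocol P"
    and "execution_of P R"
    and "correct P R = procs P"
    and "S_first P R \<ge> GST R"
    and "view_timeout P 1 > 4 * delta R"
    and "leader P 1 \<in> correct P R"
  shows "\<forall>i\<in>correct P R. \<exists>x t. decides_at R i x t \<and> t \<le> S_last P R + 3 * delta R"
proof -
  interpret view1_run P R using assms by unfold_locales auto
  show ?thesis using fast_decision assms(3) by simp
qed

end
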